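(* Let $\mathcal{Z}$ and $\mathcal{A}$ be finite alphabets and let $Q_Z$ be a probability mass function on $\mathcal{Z}$, not depending on $n$. For each $n\ge1$ let $f=f_n:\mathcal{Z}^n\to\mathcal{A}^n$ be an invertible mapping, let $Z^n=(Z_1,\dots,Z_n)$ be independent and identically distributed with distribution $Q_Z$, and let the target distribution $Q_{A^n}$ be the distribution of $A^n=f(Z^n)$. Let $\mathcal{S}_n$ be an optimal distribution matcher code for $Q_{A^n}$, i.e., a nonempty subset of $\mathcal{A}^n$ that minimizes $\mathbb{D}(P_{A^n}\|Q_{A^n})$, where $P_{A^n}$ is the uniform distribution on the subset. Then, with $P_{A^n}$ the uniform distribution on $\mathcal{S}_n$, the divergence $\mathbb{D}(P_{A^n}\|Q_{A^n})$ grows as $\frac12\log_2 n$ with $n$, i.e., $$\lim_{n\to\infty}\frac{\mathbb{D}(P_{A^n}\|Q_{A^n})}{\frac12\log_2 n}=1.$$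
   Context: A distribution matcher (DM) is an invertible mapping from uniformly distributed inputs onto a set $\mathcal{S}\subseteq\mathcal{A}^n$ of sequences, called its code or codebook; its output distribution $P_{A^n}$ is therefore uniform on $\mathcal{S}$. A DM code is optimal for the target distribution $Q_{A^n}$ if it minimizes the divergence $\mathbb{D}(P_{A^n}\|Q_{A^n})$ over all nonempty codebooks $\mathcal{S}\subseteq\mathcal{A}^n$. The divergence is $\mathbb{D}(P\|Q)=\sum_{a\in\mathrm{supp}(P)}P(a)\log_2\frac{P(a)}{Q(a)}$, equal to $+\infty$ if $Q(a)=0$ for some $a\in\mathrm{supp}(P)$.
   Formalization: The formal theorem additionally assumes that Q_Z is not uniform on its support; if Q_Z is uniform on its support, the optimal divergence is 0 for every n and the claimed limit 1 fails. *)

theory Defs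
  imports "HOL-Probability.Probability"
begin

definition seqs :: "nat \<Rightarrow> 'a list set" where
  "seqs n = {xs. length xs = n}"

text \<open>
  The library's \<^const>\<open>KL_divergence\<close> is real-valued and hence cannot take the value \<open>\<infinity>\<close>
  when \<open>P\<close> is not absolutely continuous with respect to \<open>Q\<close>.  The definition below is meant
  for \<open>P\<close> of finite support only.
\<close>

definition divergence :: "'a pmf \<Rightarrow> 'a pmf \<Rightarrow> ereal" where
  "divergence P Q =
     (if set_pmf P \<subseteq> set_pmf Q
      then ereal (\<Sum>a\<in>set_pmf P. pmf P a * log 2 (pmf P a / pmf Q a))
      else \<infinity>)"

definition optimal_code :: "nat \<Rightarrow> 'a::finite list pmf \<Rightarrow> 'a list set \<Rightarrow> bool" where
  "optimal_code n Q S \<longleftrightarrow>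
     is_arg_min (\<lambda>T. divergence (pmf_of_set T) Q) (\<lambda>T. T \<noteq> {} \<and> T \<subseteq> seqs n) S"

end

theory Submission
  imports Defs "HOL-Real_Asymp.Real_Asymp"
begin

text \<open>
  The bijection preserves probabilities, so only the information \<open>W = - log 2 Q(Z^n)\<close>, a sum of
  \<open>n\<close> independent non-constant terms, matters. It has two-sided concentration of order
  \<open>1 / sqrt n\<close>: every window of fixed length has probability \<open>O(1 / sqrt n)\<close>, and by Chebyshev's
  inequality and the pigeonhole principle some unit window has probability at least \<open>c / sqrt n\<close>.
  The code consisting of that heavy window has divergence at most \<open>1 - log 2 (c / sqrt n)\<close>.
  Conversely, since few sequences have information noticeably below
  \<open>log 2 (card S) + 1/2 * log 2 n\<close>, every code \<open>S\<close> has divergence at least \<open>1/2 * log 2 n - O(1)\<close>.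
\<close>

section \<open>Size of the largest binomial probability\<close>

text \<open>Consecutive values have ratio \<open>(2 * n + 1) / (2 * n + 2)\<close>. The bound
  survives each step because \<open>2 * n + 2\<close> is at least the geometric mean of
  \<open>2 * n + 1\<close> and \<open>2 * n + 3\<close>.\<close>

lemma central_binomial_upper_bound: "real ((2 * n) choose n) / 4 ^ n \<le> 1 / sqrt (2 * n + 1)"
proof (induction n)
  case 0
  show ?case by simp
next
  case (Suc n)
  define b where "b n = real ((2 * n) choose n) / 4 ^ n" for n
  have "Suc n * ((2 * Suc n) choose Suc n) = 2 * (2 * n + 1) * ((2 * n) choose n)"
  proof -
    have "Suc n * ((2 * Suc n) choose Suc n) = 2 * (((2 * n + 1) choose Suc n) * Suc n)"
      using Suc_times_binomial_eq[of "2 * n + 1" n] binomial_symmetric[of n "2 * n + 1"]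
      by (simp add: algebra_simps)
    also have "\<dots> = 2 * (2 * n + 1) * ((2 * n) choose n)"
      using Suc_times_binomial_eq[of "2 * n" n] by simp
    finally show ?thesis .
  qed
  then have "(real n + 1) * real ((2 * Suc n) choose Suc n) = 2 * (2 * n + 1) * real ((2 * n) choose n)"
    by (metis of_nat_Suc of_nat_mult of_nat_1 of_nat_add of_nat_numeral add.commute)
  then have "real ((2 * Suc n) choose Suc n) = 2 * (2 * n + 1) * real ((2 * n) choose n) / (real n + 1)"
    by (simp add: eq_divide_eq mult.commute del: binomial_Suc_Suc)
  then have step: "b (Suc n) = b n * (2 * n + 1) / (2 * n + 2)"
    unfolding b_def by (simp add: divide_simps del: binomial_Suc_Suc) (simp add: algebra_simps del: binomial_Suc_Suc)
  have "b (Suc n) \<le> 1 / sqrt (2 * n + 1) * (2 * n + 1) / (2 * n + 2)"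
    unfolding step using Suc.IH by (intro divide_right_mono mult_right_mono) (auto simp: b_def)
  also have "\<dots> = sqrt (2 * n + 1) / (2 * n + 2)"
    by (simp add: real_div_sqrt)
  also have "\<dots> \<le> 1 / sqrt (2 * n + 3)"
  proof -
    have "sqrt (2 * n + 1) * sqrt (2 * n + 3) = sqrt ((2 * real n + 1) * (2 * real n + 3))"
      by (simp add: real_sqrt_mult [symmetric] add.commute)
    also have "\<dots> \<le> 2 * n + 2"
      by (rule real_le_lsqrt) (auto simp: power2_eq_square algebra_simps)
    finally show ?thesis by (simp add: field_simps)
  qed
  finally show ?case by (simp add: b_def algebra_simps)
qed

text \<open>The middle coefficient is the largest. For odd \<open>m = 2 * i + 1\<close> it is half
  of the central coefficient of \<open>2 * Suc i\<close>, so both parities reduce to the central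
  bound.\<close>

lemma binomial_div_power2_le: "real (m choose k) / 2 ^ m \<le> 1 / sqrt (m + 1)"
proof -
  have "real (m choose k) / 2 ^ m \<le> real (m choose (m div 2)) / 2 ^ m"
    by (intro divide_right_mono) (auto simp: binomial_maximum)
  also have "\<dots> \<le> 1 / sqrt (m + 1)"
  proof (cases "even m")
    case True
    then obtain i where "m = 2 * i" by blast
    then show ?thesis
      using central_binomial_upper_bound[of i] by (simp add: power_mult)
  next
    case False
    then obtain i where i: "m = 2 * i + 1" using oddE by blast
    have "(2 * Suc i) choose Suc i = 2 * (m choose i)"
      using binomial_symmetric[of i "2 * i + 1"] by (simp add: i)
    then have "real (m choose (m div 2)) / 2 ^ m = real ((2 * Suc i) choose Suc i) / 4 ^ Suc i"
      by (simp add: i power_mult)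
    also have "\<dots> \<le> 1 / sqrt (2 * Suc i + 1)"
      by (rule central_binomial_upper_bound)
    also have "\<dots> \<le> 1 / sqrt (m + 1)"
      by (intro divide_left_mono) (auto simp: i)
    finally show ?thesis .
  qed
  finally show ?thesis .
qed

section \<open>Conditioning on the first letter of an i.i.d. word\<close>

lemma expectation_replicate_pmf_Suc:
  fixes p :: "'z::finite pmf" and h :: "'z list \<Rightarrow> real"
  shows "measure_pmf.expectation (replicate_pmf (Suc n) p) h =
    (\<Sum>z\<in>UNIV. pmf p z * measure_pmf.expectation (replicate_pmf n p) (\<lambda>xs. h (z # xs)))"
proof -
  have fin: "finite (set_pmf (replicate_pmf n p))"
    using finite_lists_length_eq[of "set_pmf p" n]
    by (rule rev_finite_subset) (auto simp: set_replicate_pmf)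
  have eq: "replicate_pmf (Suc n) p = p \<bind> (\<lambda>z. map_pmf ((#) z) (replicate_pmf n p))"
    by (simp add: map_pmf_def)
  show ?thesis
    unfolding eq using fin by (subst pmf_expectation_bind[where A = UNIV]) auto
qed

lemma prob_replicate_pmf_Suc:
  fixes p :: "'z::finite pmf"
  shows "measure_pmf.prob (replicate_pmf (Suc n) p) A =
    (\<Sum>z\<in>UNIV. pmf p z * measure_pmf.prob (replicate_pmf n p) {xs. z # xs \<in> A})"
proof -
  have "(\<lambda>xs. indicator A (z # xs)) = (indicator {xs. z # xs \<in> A} :: _ \<Rightarrow> real)" for z
    by (auto simp: indicator_def)
  then show ?thesis
    using expectation_replicate_pmf_Suc[of n p "indicator A"]
    by (simp del: replicate_pmf.simps)
qed

section \<open>Anti-concentration of sums of independent letters\<close>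

text \<open>A half-open interval of length \<open>D\<close> contains exactly one integer multiple of
  \<open>D\<close>, so at most one binomial term survives.\<close>

lemma binomial_window_le:
  fixes D t :: real
  assumes "D > 0"
  shows "(\<Sum>k\<le>m. real (m choose k) / 2 ^ m * of_bool (t < k * D \<and> k * D \<le> t + D))
    \<le> 1 / sqrt (real m + 1)"
proof -
  define j where "j = nat (floor (t / D) + 1)"
  have j: "k = j" if "t < real k * D" "real k * D \<le> t + D" for k
  proof -
    have "t / D < real k" "real k \<le> t / D + 1"
      using that assms by (auto simp: field_simps)
    then have "floor (t / D) + 1 = int k"
      by linarith
    then show ?thesis by (simp add: j_def)
  qed
  have "(\<Sum>k\<le>m. real (m choose k) / 2 ^ m * of_bool (t < k * D \<and> k * D \<le> t + D))
    \<le> (\<Sum>k\<le>m. if k = j then real (m choose k) / 2 ^ m else 0)"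
    by (intro sum_mono) (use j in \<open>auto simp: of_bool_def\<close>)
  also have "\<dots> \<le> 1 / sqrt (real m + 1)"
    using binomial_div_power2_le[of m j] by (simp add: sum.delta add.commute)
  finally show ?thesis .
qed

text \<open>Pascal's rule read probabilistically: one more fair coin shifts the count by 0 or
  1.\<close>

lemma sum_binomial_Suc:
  fixes g :: "nat \<Rightarrow> real"
  shows "(\<Sum>k\<le>Suc m. real (Suc m choose k) * g k) = (\<Sum>k\<le>m. real (m choose k) * (g k + g (Suc k)))"
proof -
  have "(\<Sum>k\<le>Suc m. real (Suc m choose k) * g k)
    = g 0 + (\<Sum>k\<le>m. real (m choose Suc k) * g (Suc k)) + (\<Sum>k\<le>m. real (m choose k) * g (Suc k))"
    by (subst sum.atMost_Suc_shift) (simp add: algebra_simps sum.distrib)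
  also have "g 0 + (\<Sum>k\<le>m. real (m choose Suc k) * g (Suc k)) = (\<Sum>k\<le>Suc m. real (m choose k) * g k)"
    by (subst sum.atMost_Suc_shift) simp
  also have "\<dots> = (\<Sum>k\<le>m. real (m choose k) * g k)"
    by simp
  finally show ?thesis by (simp add: algebra_simps sum.distrib)
qed

text \<open>Serves the induction in \<open>coin_window_prob_le\<close>: with weight
  \<open>2 * a\<close> a letter becomes an extra coin, raising \<open>t\<close> to
  \<open>t + 1\<close>; otherwise \<open>t\<close> stays. Convexity of the square reduces the claim
  to comparing the weighted mean of \<open>1 / (t + 1)\<close> and \<open>1 / t\<close> with
  \<open>1 / (t + a)\<close>.\<close>

lemma inverse_sqrt_step:
  fixes t a :: real
  assumes "t \<ge> 1" "a \<ge> 0" "2 * a \<le> 1"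
  shows "2 * a * (1 / sqrt (t + 1)) + (1 - 2 * a) * (1 / sqrt t) \<le> 1 / sqrt (t + a)"
proof -
  define u v where "u = 1 / sqrt (t + 1)" and "v = 1 / sqrt t"
  have u2: "u\<^sup>2 = 1 / (t + 1)" and v2: "v\<^sup>2 = 1 / t"
    using assms by (auto simp: u_def v_def power_divide)
  have "(2 * a * u + (1 - 2 * a) * v)\<^sup>2
    = 2 * a * u\<^sup>2 + (1 - 2 * a) * v\<^sup>2 - (2 * a) * (1 - 2 * a) * (u - v)\<^sup>2"
    by (simp add: power2_eq_square algebra_simps)
  also have "\<dots> \<le> 2 * a * (1 / (t + 1)) + (1 - 2 * a) * (1 / t)"
    using assms by (simp add: u2 v2)
  also have "\<dots> = (t + 1 - 2 * a) / (t * (t + 1))"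
    using assms by (simp add: divide_simps) (simp add: algebra_simps)
  also have "\<dots> \<le> 1 / (t + a)"
  proof -
    have "0 \<le> a * (t - 1)" using assms by simp
    moreover have "(t + 1 - 2 * a) * (t + a) = t * (t + 1) - a * (t - 1) - 2 * a\<^sup>2"
      by (simp add: power2_eq_square algebra_simps)
    ultimately have "(t + 1 - 2 * a) * (t + a) \<le> t * (t + 1)"
      using zero_le_power2[of a] by linarith
    then show ?thesis using assms by (simp add: divide_simps mult.commute)
  qed
  also have "\<dots> = (1 / sqrt (t + a))\<^sup>2"
    using assms by (simp add: power_divide)
  finally have "2 * a * u + (1 - 2 * a) * v \<le> 1 / sqrt (t + a)"
    by (rule power2_le_imp_le) (use assms in simp)
  then show ?thesis by (simp add: u_def v_def)
qed

text \<open>Isolates a fair choice between \<open>x\<close> and \<open>y\<close>. If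
  \<open>q\<close> is a probability vector and \<open>a\<close> is at most \<open>q x\<close> and
  \<open>q y\<close>, the leftover weights are nonnegative with sum
  \<open>1 - 2 * a\<close>.\<close>

lemma sum_split_two_points:
  fixes q g :: "'z::finite \<Rightarrow> real"
  assumes "x \<noteq> y"
  shows "(\<Sum>z\<in>UNIV. q z * g z) = a * (g x + g y) + (\<Sum>z\<in>UNIV. (q z - a * of_bool (z \<in> {x, y})) * g z)"
proof -
  have "(\<Sum>z\<in>UNIV. a * of_bool (z \<in> {x, y}) * g z) = (\<Sum>z\<in>{x, y}. a * g z)"
    by (intro sum.mono_neutral_cong_right) auto
  then show ?thesis
    using assms by (simp add: algebra_simps sum_subtractf sum.distrib)
qed

text \<open>
  Each letter equals, with probability \<open>2 * a\<close>, a fair choice between \<open>x\<close> and \<open>y\<close>. Splitting off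
  these choices one letter at a time leaves a mixture of \<open>m\<close> fair coins of step \<open>D\<close>.
\<close>

lemma coin_window_prob_le:
  fixes p :: "'z::finite pmf" and L :: "'z \<Rightarrow> real"
  assumes D: "D = L y - L x" "D > 0"
    and a: "a = min (pmf p x) (pmf p y)"
  shows "(\<Sum>k\<le>m. real (m choose k) / 2 ^ m * measure_pmf.prob (replicate_pmf n p)
      {xs. t < sum_list (map L xs) + k * D \<and> sum_list (map L xs) + k * D \<le> t + D})
    \<le> 1 / sqrt (m + 1 + a * n)"
proof -
  define G where "G n t = measure_pmf.prob (replicate_pmf n p)
      {xs. t < sum_list (map L xs) \<and> sum_list (map L xs) \<le> t + D}" for n t
  \<comment> \<open>The window probability for \<open>n\<close> letters plus \<open>m\<close> coins.
    The induction on \<open>n\<close> needs all \<open>m\<close>, since a letter may turn into a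
    coin.\<close>
  define F where "F n m t = (\<Sum>k\<le>m. real (m choose k) / 2 ^ m * G n (t - k * D))" for n m t
  have xy: "x \<noteq> y" using D by auto
  have a0: "a \<ge> 0" using a by simp
  have a1: "2 * a \<le> 1"
  proof -
    have "pmf p x + pmf p y = (\<Sum>z\<in>{x, y}. pmf p z)" using xy by simp
    also have "\<dots> \<le> 1" by (metis finite.emptyI finite.insertI measure_measure_pmf_finite measure_pmf.prob_le_1)
    finally show ?thesis using a by linarith
  qed
  have G_Suc: "G (Suc n) t = (\<Sum>z\<in>UNIV. pmf p z * G n (t - L z))" for n t
    unfolding G_def prob_replicate_pmf_Suc by (simp add: algebra_simps)
  have F_Suc: "F (Suc n) m t = (\<Sum>z\<in>UNIV. pmf p z * F n m (t - L z))" for n m t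
    unfolding F_def G_Suc sum_distrib_left by (subst sum.swap) (simp add: algebra_simps)
  \<comment> \<open>A fair choice between \<open>L x\<close> and \<open>L y\<close> is
    \<open>L x\<close> plus one fair coin of step \<open>D\<close>.\<close>
  have coin: "F n m (t - L x) + F n m (t - L y) = 2 * F n (Suc m) (t - L x)" for n m t
  proof -
    let ?g = "\<lambda>k. G n (t - L x - real k * D)"
    have shift: "t - L y - real k * D = t - L x - real (Suc k) * D" for k
      using D(1) by (simp add: algebra_simps)
    have "2 * F n (Suc m) (t - L x) = (\<Sum>k\<le>Suc m. real (Suc m choose k) * ?g k) / 2 ^ m"
      by (simp add: F_def sum_divide_distrib sum_distrib_left del: sum.atMost_Suc binomial_Suc_Suc)
    also have "\<dots> = (\<Sum>k\<le>m. real (m choose k) * (?g k + ?g (Suc k))) / 2 ^ m"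
      by (simp only: sum_binomial_Suc)
    also have "\<dots> = F n m (t - L x) + F n m (t - L y)"
      by (simp only: F_def shift sum_divide_distrib distrib_left add_divide_distrib sum.distrib
          times_divide_eq_left)
    finally show ?thesis by simp
  qed
  have "F n m t \<le> 1 / sqrt (m + 1 + a * n)"
  proof (induction n arbitrary: m t)
    case 0
    have "F 0 m t = (\<Sum>k\<le>m. real (m choose k) / 2 ^ m * of_bool (t < k * D \<and> k * D \<le> t + D))"
      by (auto simp: F_def G_def indicator_def algebra_simps intro!: sum.cong)
    then show ?case
      using binomial_window_le[OF D(2), of m t] by (simp add: add.commute)
  next
    case (Suc n)
    define w where "w z = pmf p z - a * of_bool (z \<in> {x, y})" for z
    define h where "h m = 1 / sqrt (real m + 1 + a * real n)" for m
    have IH: "F n m t \<le> h m" for m t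
      using Suc.IH[of m t] by (simp add: h_def add.commute)
    have w0: "w z \<ge> 0" for z using a by (auto simp: w_def of_bool_def)
    have w1: "(\<Sum>z\<in>UNIV. w z) = 1 - 2 * a"
      using sum_split_two_points[OF xy, of "pmf p" "\<lambda>_. 1" a] by (simp add: w_def sum_pmf_eq_1)
    have "F (Suc n) m t = a * (F n m (t - L x) + F n m (t - L y)) + (\<Sum>z\<in>UNIV. w z * F n m (t - L z))"
      unfolding F_Suc w_def by (rule sum_split_two_points[OF xy])
    \<comment> \<open>The bound from the induction hypothesis is uniform in \<open>t\<close>, so the
      shifts by \<open>L z\<close> do not matter.\<close>
    also have "\<dots> \<le> a * (2 * h (Suc m)) + (\<Sum>z\<in>UNIV. w z * h m)"
      unfolding coin using a0 w0 IH
      by (intro add_mono mult_left_mono sum_mono) auto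
    also have "\<dots> = 2 * a * h (Suc m) + (1 - 2 * a) * h m"
      by (simp add: w1 flip: sum_distrib_right)
    also have "\<dots> \<le> 1 / sqrt (m + 1 + a * Suc n)"
      using inverse_sqrt_step[of "real m + 1 + a * n" a] a0 a1 by (simp add: h_def algebra_simps)
    finally show ?case .
  qed
  then show ?thesis by (simp add: F_def G_def algebra_simps)
qed

lemma window_prob_le:
  fixes p :: "'z::finite pmf" and L :: "'z \<Rightarrow> real"
  assumes "L x < L y"
  shows "measure_pmf.prob (replicate_pmf n p)
      {xs. t < sum_list (map L xs) \<and> sum_list (map L xs) \<le> t + (L y - L x)}
    \<le> 1 / sqrt (1 + min (pmf p x) (pmf p y) * n)"
  using coin_window_prob_le[of "L y - L x" L y x _ p 0 n t] assms by simp

section \<open>Divergence of a uniform code in terms of information\<close>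

lemma divergence_pmf_of_set:
  assumes "finite T" "T \<noteq> {}" "T \<subseteq> set_pmf P"
  shows "divergence (pmf_of_set T) P =
    ereal ((\<Sum>x\<in>T. - log 2 (pmf P x)) / card T - log 2 (card T))"
proof -
  have M: "card T > 0" using assms by (simp add: card_gt_0_iff)
  have "(\<Sum>x\<in>T. 1 / card T * log 2 ((1 / card T) / pmf P x))
    = (\<Sum>x\<in>T. - log 2 (pmf P x) / card T - log 2 (card T) / card T)"
  proof (rule sum.cong)
    fix x assume "x \<in> T"
    then have "pmf P x > 0" using assms by (auto intro: pmf_positive)
    then show "1 / card T * log 2 ((1 / card T) / pmf P x)
      = - log 2 (pmf P x) / card T - log 2 (card T) / card T"
      using M by (simp add: log_divide log_mult field_simps)
  qed simp
  also have "\<dots> = (\<Sum>x\<in>T. - log 2 (pmf P x)) / card T - log 2 (card T)"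
    using M by (simp add: sum_subtractf sum_divide_distrib)
  finally show ?thesis
    using assms by (simp add: divergence_def)
qed

text \<open>Each point of \<open>T\<close> has probability at most \<open>2 powr (- t)\<close>, so
  \<open>log 2 (card T)\<close> is at least \<open>t\<close> plus the logarithm of the mass of
  \<open>T\<close>. The mean information is at most \<open>t + 1\<close>, and \<open>t\<close>
  cancels.\<close>

lemma divergence_le:
  assumes T: "finite T" "T \<noteq> {}" "T \<subseteq> set_pmf P"
    and W: "\<And>x. x \<in> T \<Longrightarrow> t \<le> - log 2 (pmf P x) \<and> - log 2 (pmf P x) \<le> t + 1"
  shows "divergence (pmf_of_set T) P \<le> ereal (1 - log 2 (measure_pmf.prob P T))"
proof -
  have M: "card T > 0" using T by (simp add: card_gt_0_iff)
  have pos: "pmf P x > 0" if "x \<in> T" for x using T that by (auto intro: pmf_positive)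
  have "measure_pmf.prob P T = (\<Sum>x\<in>T. pmf P x)"
    using T by (simp add: measure_measure_pmf_finite)
  also have "\<dots> \<le> (\<Sum>x\<in>T. 2 powr (- t))"
  proof (intro sum_mono)
    fix x assume x: "x \<in> T"
    then have "log 2 (pmf P x) \<le> - t" using W[of x] by simp
    then show "pmf P x \<le> 2 powr (- t)" using pos[OF x] by (simp add: log_le_iff)
  qed
  finally have "measure_pmf.prob P T \<le> card T * 2 powr (- t)" by simp
  moreover have "measure_pmf.prob P T > 0"
    using T pos by (simp add: measure_measure_pmf_finite sum_pos)
  ultimately have "log 2 (measure_pmf.prob P T) \<le> log 2 (card T * 2 powr (- t))"
    using M by (subst log_le_cancel_iff) auto
  also have "\<dots> = log 2 (card T) - t" using M by (simp add: log_mult)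
  finally have 1: "log 2 (measure_pmf.prob P T) \<le> log 2 (card T) - t" .
  have "(\<Sum>x\<in>T. - log 2 (pmf P x)) \<le> (\<Sum>x\<in>T. t + 1)"
    using W by (intro sum_mono) auto
  then have "(\<Sum>x\<in>T. - log 2 (pmf P x)) / card T \<le> t + 1"
    using M by (simp add: divide_le_eq mult.commute)
  with 1 show ?thesis
    using divergence_pmf_of_set[OF T] by simp
qed

text \<open>
  Writing \<open>W = - log 2 (pmf P x)\<close> and \<open>v = log 2 (card T) - log 2 \<epsilon>\<close>, the divergence is
  \<open>- log 2 \<epsilon>\<close> plus the mean of \<open>W - v\<close> over \<open>T\<close>. A window of length \<open>D\<close> lying \<open>j * D\<close> below \<open>v\<close>
  holds at most \<open>\<epsilon> * 2 powr (v - j * D)\<close> points, so values \<open>W < v\<close> lower that mean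
  by a bounded amount only.
\<close>

lemma divergence_ge:
  assumes T: "finite T" "T \<noteq> {}" and D: "D > 0" and \<epsilon>: "\<epsilon> > 0"
    and window: "\<And>t. measure_pmf.prob P {x. t < - log 2 (pmf P x) \<and> - log 2 (pmf P x) \<le> t + D} \<le> \<epsilon>"
  shows "ereal (- log 2 \<epsilon> - D / (1 - 2 powr (- D))\<^sup>2) \<le> divergence (pmf_of_set T) P"
proof (cases "T \<subseteq> set_pmf P")
  case False
  then show ?thesis using T by (simp add: divergence_def)
next
  case True
  define W where "W x = - log 2 (pmf P x)" for x
  define M where "M = real (card T)"
  define v where "v = log 2 M - log 2 \<epsilon>"
  define r where "r = 2 powr (- D)"
  define j where "j x = nat \<lfloor>(v - W x) / D\<rfloor>" for x
  define T' where "T' = {x \<in> T. W x \<le> v}"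
  have M: "M > 0" using T by (simp add: M_def card_gt_0_iff)
  have r: "0 < r" "r < 1" using D by (auto simp: r_def powr_less_one)
  have rpow: "r ^ i = 2 powr (- (i * D))" for i
    by (simp add: r_def powr_realpow[symmetric] powr_powr mult.commute)
  have v: "2 powr v = M / \<epsilon>" using M \<epsilon> by (simp add: v_def powr_diff)
  have finT': "finite T'" using T by (simp add: T'_def)
  have pmfW: "pmf P x = 2 powr (- W x)" if "x \<in> T" for x
    using True that pmf_positive[of x P] by (auto simp: W_def)
  have j: "j x * D \<le> v - W x" "v - W x < (j x + 1) * D" if "x \<in> T'" for x
  proof -
    have "(v - W x) / D \<ge> 0" using that D by (simp add: T'_def)
    then have "real (j x) \<le> (v - W x) / D" "(v - W x) / D < real (j x) + 1"
      unfolding j_def by linarith+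
    then show "j x * D \<le> v - W x" "v - W x < (j x + 1) * D"
      using D by (auto simp: field_simps)
  qed
  have layer: "(\<Sum>x | x \<in> T' \<and> j x = i. v - W x) \<le> M * D * (real (Suc i) * r ^ i)" for i
  proof -
    let ?B = "{x \<in> T'. j x = i}"
    have jB: "i * D \<le> v - W x" "v - W x < (i + 1) * D" if "x \<in> ?B" for x
      using j[of x] that by auto
    have "card ?B * 2 powr (- (v - i * D)) = (\<Sum>x\<in>?B. 2 powr (- (v - i * D)))" by simp
    also have "\<dots> \<le> (\<Sum>x\<in>?B. pmf P x)"
    proof (intro sum_mono)
      fix x assume x: "x \<in> ?B"
      then show "2 powr (- (v - i * D)) \<le> pmf P x"
        using jB(1)[OF x] by (simp add: pmfW T'_def)
    qed
    also have "\<dots> = measure_pmf.prob P ?B"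
      using finT' by (simp add: measure_measure_pmf_finite)
    \<comment> \<open>Rounding down puts \<open>v - W x\<close> in an interval closed on the left
      and open on the right; reflecting it gives the orientation of the window hypothesis.\<close>
    also have "\<dots> \<le> measure_pmf.prob P
        {x. v - (i + 1) * D < - log 2 (pmf P x) \<and> - log 2 (pmf P x) \<le> v - (i + 1) * D + D}"
    proof (intro measure_pmf.finite_measure_mono subsetI)
      fix x assume x: "x \<in> ?B"
      show "x \<in> {x. v - (i + 1) * D < - log 2 (pmf P x) \<and> - log 2 (pmf P x) \<le> v - (i + 1) * D + D}"
        using jB[OF x] by (simp add: W_def algebra_simps)
    qed simp
    also have "\<dots> \<le> \<epsilon>" by (rule window)
    finally have "card ?B * 2 powr (- (v - i * D)) \<le> \<epsilon>" .
    then have "card ?B \<le> \<epsilon> * 2 powr (v - i * D)"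
      by (simp only: powr_minus inverse_eq_divide times_divide_eq_right mult_1_right)
        (simp add: pos_divide_le_eq)
    also have "\<dots> = M * r ^ i"
      using \<epsilon> by (simp add: rpow powr_diff powr_minus v divide_simps)
    finally have card: "card ?B \<le> M * r ^ i" .
    have "(\<Sum>x\<in>?B. v - W x) \<le> (\<Sum>x\<in>?B. (i + 1) * D)"
      using jB(2) by (intro sum_mono) force
    also have "\<dots> = card ?B * ((i + 1) * D)" by simp
    also have "\<dots> \<le> M * r ^ i * ((i + 1) * D)"
      using card D by (intro mult_right_mono) auto
    finally show ?thesis by (simp add: algebra_simps)
  qed
  \<comment> \<open>The differentiated geometric series: layer \<open>i\<close> has deficit at most
    \<open>Suc i * D\<close> per point and at most \<open>M * r ^ i\<close> points.\<close>
  have sums: "(\<lambda>i. M * D * (real (Suc i) * r ^ i)) sums (M * D * (1 / (1 - r)\<^sup>2))"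
    using r by (intro sums_mult geometric_deriv_sums) auto
  \<comment> \<open>Points with \<open>W x > v\<close> contribute negative terms and are
    dropped.\<close>
  have "(\<Sum>x\<in>T. v - W x) \<le> (\<Sum>x\<in>T'. v - W x)"
  proof -
    have "(\<Sum>x\<in>T'. v - W x) = (\<Sum>x\<in>T. if W x \<le> v then v - W x else 0)"
      using T by (simp add: T'_def sum.inter_filter)
    then show ?thesis by (auto intro!: sum_mono)
  qed
  also have "\<dots> = (\<Sum>i\<in>j ` T'. \<Sum>x | x \<in> T' \<and> j x = i. v - W x)"
    by (rule sum.image_gen[OF finT'])
  also have "\<dots> \<le> (\<Sum>i\<in>j ` T'. M * D * (real (Suc i) * r ^ i))"
    by (intro sum_mono layer)
  also have "\<dots> \<le> M * D * (1 / (1 - r)\<^sup>2)"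
    unfolding sums_unique[OF sums]
    using sums finT' M D r by (intro sum_le_suminf) (auto simp: sums_iff)
  finally have "M * v - (\<Sum>x\<in>T. W x) \<le> M * (D / (1 - r)\<^sup>2)"
    by (simp add: sum_subtractf M_def)
  then have "v - (\<Sum>x\<in>T. W x) / M \<le> D / (1 - r)\<^sup>2"
    using M by (simp add: field_simps)
  then show ?thesis
    unfolding divergence_pmf_of_set[OF T True] W_def[symmetric] M_def[symmetric] r_def[symmetric]
    by (simp add: v_def)
qed

section \<open>Information and second moment of an i.i.d. word\<close>

lemma pmf_replicate_pmf:
  fixes p :: "'z::finite pmf"
  assumes "length xs = n"
  shows "pmf (replicate_pmf n p) xs = prod_list (map (pmf p) xs)"
  using assms
proof (induction xs arbitrary: n)
  case Nil
  then show ?case by simp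
next
  case (Cons x xs)
  then obtain m where n: "n = Suc m" and m: "length xs = m" by auto
  have "{ys. z # ys \<in> {x # xs}} = (if z = x then {xs} else {})" for z
    by auto
  then have "measure_pmf.prob (replicate_pmf n p) {x # xs}
    = (\<Sum>z\<in>UNIV. if z = x then pmf p x * pmf (replicate_pmf m p) xs else 0)"
    unfolding n prob_replicate_pmf_Suc by (intro sum.cong) (auto simp: measure_pmf_single)
  then show ?case
    using Cons.IH[OF m] by (simp add: measure_pmf_single)
qed

text \<open>The logarithm turns the product into a sum once all factors are positive, which
  membership in the support guarantees.\<close>

lemma log_pmf_replicate_pmf:
  fixes p :: "'z::finite pmf"
  assumes "xs \<in> set_pmf (replicate_pmf n p)"
  shows "- log 2 (pmf (replicate_pmf n p) xs) = sum_list (map (\<lambda>z. - log 2 (pmf p z)) xs)"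
proof -
  have "- log 2 (prod_list (map (pmf p) xs)) = sum_list (map (\<lambda>z. - log 2 (pmf p z)) xs)
      \<and> prod_list (map (pmf p) xs) > 0"
    if "set xs \<subseteq> set_pmf p" for xs
    using that by (induction xs) (auto simp: log_mult pmf_positive set_pmf_iff)
  with assms show ?thesis
    by (auto simp: set_replicate_pmf pmf_replicate_pmf)
qed

text \<open>Variances of independent letters add, the cross term vanishing by the zero mean. The
  offset \<open>c\<close> lets the induction absorb the first letter.\<close>

lemma second_moment_replicate_pmf:
  fixes p :: "'z::finite pmf" and L :: "'z \<Rightarrow> real"
  assumes "(\<Sum>z\<in>UNIV. pmf p z * L z) = 0"
  shows "measure_pmf.expectation (replicate_pmf n p) (\<lambda>xs. (c + sum_list (map L xs))\<^sup>2)
    = c\<^sup>2 + n * (\<Sum>z\<in>UNIV. pmf p z * (L z)\<^sup>2)"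
proof (induction n arbitrary: c)
  case 0
  show ?case by simp
next
  case (Suc n)
  define s where "s = (\<Sum>z\<in>UNIV. pmf p z * (L z)\<^sup>2)"
  have one: "(\<Sum>z\<in>UNIV. pmf p z) = 1" by (simp add: sum_pmf_eq_1)
  have "measure_pmf.expectation (replicate_pmf (Suc n) p) (\<lambda>xs. (c + sum_list (map L xs))\<^sup>2)
    = (\<Sum>z\<in>UNIV. pmf p z * ((c + L z)\<^sup>2 + n * s))"
    unfolding expectation_replicate_pmf_Suc using Suc.IH by (simp add: s_def flip: add.assoc)
  also have "\<dots> = (\<Sum>z\<in>UNIV. pmf p z * (c\<^sup>2 + n * s) + 2 * c * (pmf p z * L z) + pmf p z * (L z)\<^sup>2)"
    by (intro sum.cong) (auto simp: power2_eq_square algebra_simps)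
  also have "\<dots> = (\<Sum>z\<in>UNIV. pmf p z) * (c\<^sup>2 + n * s) + 2 * c * (\<Sum>z\<in>UNIV. pmf p z * L z) + s"
    by (simp only: sum.distrib sum_distrib_left sum_distrib_right s_def)
  also have "\<dots> = c\<^sup>2 + Suc n * s"
    by (simp only: one assms) (simp add: algebra_simps)
  finally show ?case by (simp add: s_def)
qed

section \<open>Existence of a heavy unit window\<close>

text \<open>Chebyshev leaves mass at least 1/2 where the modulus of \<open>g\<close> is below
  \<open>s\<close>. At most \<open>2 * s + 2\<close>, hence at most \<open>4 * s\<close>, unit
  windows with integer endpoints cover this range, so one has mass at least
  \<open>1 / (8 * s)\<close>.\<close>

lemma heavy_unit_window:
  fixes P :: "'a pmf" and g :: "'a \<Rightarrow> real"
  assumes int: "integrable P (\<lambda>x. (g x)\<^sup>2)"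
    and s: "2 * measure_pmf.expectation P (\<lambda>x. (g x)\<^sup>2) \<le> s\<^sup>2" "s \<ge> 1"
  shows "\<exists>t. measure_pmf.prob P {x. t \<le> g x \<and> g x \<le> t + 1} \<ge> 1 / (8 * s)"
proof (rule ccontr)
  assume "\<not> ?thesis"
  then have light: "measure_pmf.prob P {x. t \<le> g x \<and> g x \<le> t + 1} < 1 / (8 * s)" for t
    by (meson not_le)
  let ?K = "{\<lfloor>-s\<rfloor>..\<lfloor>s\<rfloor>}"
  have "measure_pmf.prob P {x \<in> space P. (g x)\<^sup>2 \<ge> s\<^sup>2}
      \<le> measure_pmf.expectation P (\<lambda>x. (g x)\<^sup>2) / s\<^sup>2"
    using int s by (intro integral_Markov_inequality_measure) auto
  also have "\<dots> \<le> 1 / 2" using s by (simp add: divide_le_eq)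
  finally have "measure_pmf.prob P (- {x. (g x)\<^sup>2 \<ge> s\<^sup>2}) \<ge> 1 / 2"
    using measure_pmf.prob_compl[of "{x. (g x)\<^sup>2 \<ge> s\<^sup>2}" P] by (simp add: Compl_eq_Diff_UNIV)
  also have "measure_pmf.prob P (- {x. (g x)\<^sup>2 \<ge> s\<^sup>2})
      \<le> measure_pmf.prob P (\<Union>k\<in>?K. {x. of_int k \<le> g x \<and> g x \<le> of_int k + 1})"
  proof (intro measure_pmf.finite_measure_mono subsetI)
    fix x assume "x \<in> - {x. (g x)\<^sup>2 \<ge> s\<^sup>2}"
    then have "\<bar>g x\<bar> < s" using s abs_le_square_iff[of s "g x"] by auto
    then have "\<lfloor>g x\<rfloor> \<in> ?K" by (auto intro!: floor_mono)
    moreover have "of_int \<lfloor>g x\<rfloor> \<le> g x" "g x \<le> of_int \<lfloor>g x\<rfloor> + 1" by linarith+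
    ultimately show "x \<in> (\<Union>k\<in>?K. {x. of_int k \<le> g x \<and> g x \<le> of_int k + 1})" by blast
  qed simp
  also have "\<dots> \<le> (\<Sum>k\<in>?K. measure_pmf.prob P {x. of_int k \<le> g x \<and> g x \<le> of_int k + 1})"
    by (intro measure_pmf.finite_measure_subadditive_finite) auto
  also have "\<dots> < (\<Sum>k\<in>?K. 1 / (8 * s))"
    using light s by (intro sum_strict_mono) (auto intro!: floor_mono)
  also have "\<dots> = real (card ?K) / (8 * s)" by simp
  also have "\<dots> \<le> 4 * s / (8 * s)"
  proof (intro divide_right_mono)
    show "real (card ?K) \<le> 4 * s" using s by simp linarith
  qed (use s in auto)
  also have "\<dots> = 1 / 2" using s by simp
  finally show False by simp
qed

lemma heavy_unit_window_replicate_pmf: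
  fixes p :: "'z::finite pmf" and L :: "'z \<Rightarrow> real"
  obtains c where "c > 0"
    "\<And>n. n \<ge> 1 \<Longrightarrow> \<exists>t. measure_pmf.prob (replicate_pmf n p)
       {xs. t \<le> sum_list (map L xs) \<and> sum_list (map L xs) \<le> t + 1} \<ge> c / sqrt n"
proof -
  define \<mu> where "\<mu> = (\<Sum>z\<in>UNIV. pmf p z * L z)"
  define s where "s = (\<Sum>z\<in>UNIV. pmf p z * (L z - \<mu>)\<^sup>2)"
  \<comment> \<open>In the square of \<open>c * sqrt n\<close>, the term \<open>2 * s\<close>
    supplies the factor 2 for Chebyshev and the \<open>1\<close> ensures that the radius is at least
    1.\<close>
  define c where "c = sqrt (2 * s + 1)"
  have s0: "s \<ge> 0" by (auto simp: s_def intro!: sum_nonneg)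
  have c1: "c \<ge> 1" using s0 by (simp add: c_def)
  have centered: "(\<Sum>z\<in>UNIV. pmf p z * (L z - \<mu>)) = 0"
    by (simp add: right_diff_distrib sum_subtractf sum_pmf_eq_1 flip: sum_distrib_right \<mu>_def)
  have "\<exists>t. measure_pmf.prob (replicate_pmf n p)
       {xs. t \<le> sum_list (map L xs) \<and> sum_list (map L xs) \<le> t + 1} \<ge> 1 / (8 * c) / sqrt n"
    if n: "n \<ge> 1" for n
  proof -
    let ?g = "\<lambda>xs. sum_list (map (\<lambda>z. L z - \<mu>) xs)"
    have fin: "finite (set_pmf (replicate_pmf n p))"
      using finite_lists_length_eq[of "set_pmf p" n]
      by (rule rev_finite_subset) (auto simp: set_replicate_pmf)
    have "measure_pmf.expectation (replicate_pmf n p) (\<lambda>xs. (?g xs)\<^sup>2) = n * s"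
      using second_moment_replicate_pmf[OF centered, of n 0] by (simp add: s_def)
    moreover have "2 * (n * s) \<le> (c * sqrt n)\<^sup>2"
      using s0 by (simp add: c_def power_mult_distrib algebra_simps)
    moreover have "c * sqrt n \<ge> 1"
      using c1 n mult_mono[of 1 c 1 "sqrt n"] by simp
    ultimately obtain t where t: "1 / (8 * (c * sqrt n))
        \<le> measure_pmf.prob (replicate_pmf n p) {xs. t \<le> ?g xs \<and> ?g xs \<le> t + 1}"
      using heavy_unit_window[of "replicate_pmf n p" ?g "c * sqrt n"] fin
      by (auto simp: integrable_measure_pmf_finite)
    \<comment> \<open>Centering only translates the window, since words in the support have length
      \<open>n\<close>.\<close>
    have g: "?g xs = sum_list (map L xs) - n * \<mu>" if "xs \<in> set_pmf (replicate_pmf n p)" for xs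
    proof -
      have "?g xs = sum_list (map L xs) - length xs * \<mu>"
        by (induction xs) (auto simp: algebra_simps)
      with that show ?thesis by (simp add: set_replicate_pmf)
    qed
    have "measure_pmf.prob (replicate_pmf n p) {xs. t \<le> ?g xs \<and> ?g xs \<le> t + 1}
      = measure_pmf.prob (replicate_pmf n p)
          {xs. t + n * \<mu> \<le> sum_list (map L xs) \<and> sum_list (map L xs) \<le> t + n * \<mu> + 1}"
      by (intro measure_pmf.finite_measure_eq_AE) (auto simp: AE_measure_pmf_iff g)
    with t show ?thesis by (auto simp: mult.assoc)
  qed
  with c1 show ?thesis using that[of "1 / (8 * c)"] by simp
qed

section \<open>Matching bounds for the optimal code and the limit\<close>

text \<open>Nonuniformity on the support is essential: if \<open>QZ\<close> were uniform there, the
  code \<open>set_pmf (QA n)\<close> would have divergence 0 and the limit would be 0.\<close>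

theorem theorem2:
  fixes QZ :: "'z::finite pmf"
    and f :: "nat \<Rightarrow> 'z list \<Rightarrow> 'a::finite list"
    and QA :: "nat \<Rightarrow> 'a list pmf"
    and S :: "nat \<Rightarrow> 'a list set"
  assumes nonuniform: "\<exists>x\<in>set_pmf QZ. \<exists>y\<in>set_pmf QZ. pmf QZ x \<noteq> pmf QZ y"
    and invertible: "\<And>n. n \<ge> 1 \<Longrightarrow> bij_betw (f n) (seqs n) (seqs n)"
    and target: "\<And>n. n \<ge> 1 \<Longrightarrow> QA n = map_pmf (f n) (replicate_pmf n QZ)"
    and optimal: "\<And>n. n \<ge> 1 \<Longrightarrow> optimal_code n (QA n) (S n)"
  shows "(\<lambda>n. divergence (pmf_of_set (S n)) (QA n) / ereal (1 / 2 * log 2 (real n))) \<longlonglongrightarrow> 1"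
proof -
  define L where "L z = - log 2 (pmf QZ z)" for z
  define P where "P n = replicate_pmf n QZ" for n
  define dv where "dv n = divergence (pmf_of_set (S n)) (QA n)" for n
  have P_seqs: "set_pmf (P n) \<subseteq> seqs n" for n
    by (auto simp: P_def seqs_def set_replicate_pmf)
  have inj: "inj_on (f n) (set_pmf (P n))" if "n \<ge> 1" for n
    using bij_betw_imp_inj_on[OF invertible[OF that]] P_seqs inj_on_subset by blast
  have info: "- log 2 (pmf (QA n) (f n xs)) = sum_list (map L xs)"
    if "n \<ge> 1" "xs \<in> set_pmf (P n)" for n xs
    using that inj[OF that(1)] log_pmf_replicate_pmf[of xs n QZ]
    by (simp add: target P_def L_def[abs_def] pmf_map_inj)
  \<comment> \<open>The information has the same law under \<open>QA n\<close> as the sum of letter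
    informations under \<open>P n\<close>. An arbitrary predicate \<open>R\<close> covers both the
    half-open and the closed windows.\<close>
  have prob_QA: "measure_pmf.prob (QA n) {ys. R (- log 2 (pmf (QA n) ys))}
      = measure_pmf.prob (P n) {xs. R (sum_list (map L xs))}" if "n \<ge> 1" for n R
  proof -
    have "measure_pmf.prob (QA n) {ys. R (- log 2 (pmf (QA n) ys))}
      = measure_pmf.prob (P n) {xs. R (- log 2 (pmf (QA n) (f n xs)))}"
      by (subst target[OF that]) (simp add: P_def vimage_def)
    also have "\<dots> = measure_pmf.prob (P n) {xs. R (sum_list (map L xs))}"
      by (intro measure_pmf.finite_measure_eq_AE) (simp_all add: AE_measure_pmf_iff info[OF that])
    finally show ?thesis .
  qed

  \<comment> \<open>Nonuniformity yields two letters of different information; their gap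
    \<open>D\<close> is the coin step and the window length of the lower bound.\<close>
  obtain x y where xy: "x \<in> set_pmf QZ" "y \<in> set_pmf QZ" "L x < L y"
  proof -
    obtain x y where "x \<in> set_pmf QZ" "y \<in> set_pmf QZ" "pmf QZ y < pmf QZ x"
      using nonuniform by (metis linorder_neqE_linordered_idom)
    then show ?thesis using that[of x y] by (simp add: L_def pmf_positive)
  qed
  define a where "a = min (pmf QZ x) (pmf QZ y)"
  define D where "D = L y - L x"
  define K where "K = D / (1 - 2 powr (- D))\<^sup>2"
  have a: "a > 0" using xy by (simp add: a_def pmf_positive)
  have lower: "ereal (1 / 2 * log 2 (1 + a * n) - K) \<le> dv n" if n: "n \<ge> 1" for n
  proof -
    have pos: "1 + a * n > 0" using a by (simp add: add_pos_nonneg)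
    have S: "finite (S n)" "S n \<noteq> {}"
    proof -
      have "S n \<noteq> {}" "S n \<subseteq> seqs n"
        using optimal[OF n] by (auto simp: optimal_code_def is_arg_min_def)
      moreover have "finite (seqs n :: 'a list set)"
        using finite_lists_length_eq[of "UNIV :: 'a set" n] by (simp add: seqs_def)
      ultimately show "finite (S n)" "S n \<noteq> {}" by (auto intro: finite_subset)
    qed
    have "measure_pmf.prob (QA n)
        {ys. t < - log 2 (pmf (QA n) ys) \<and> - log 2 (pmf (QA n) ys) \<le> t + D}
      \<le> 1 / sqrt (1 + a * n)" for t
      using window_prob_le[OF xy(3), of n QZ t] prob_QA[OF n, of "\<lambda>w. t < w \<and> w \<le> t + D"]
      by (simp add: D_def a_def P_def)
    then have "ereal (- log 2 (1 / sqrt (1 + a * n)) - D / (1 - 2 powr (- D))\<^sup>2) \<le> dv n"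
      unfolding dv_def using S pos xy(3) by (intro divergence_ge) (auto simp: D_def)
    moreover have "- log 2 (1 / sqrt (1 + a * n)) = 1 / 2 * log 2 (1 + a * n)"
      using pos by (simp add: log_divide powr_half_sqrt[symmetric] log_powr)
    ultimately show ?thesis by (simp add: K_def)
  qed

  obtain c where c: "c > 0" and heavy: "\<And>n. n \<ge> 1 \<Longrightarrow> \<exists>t. c / sqrt n \<le> measure_pmf.prob (P n)
       {xs. t \<le> sum_list (map L xs) \<and> sum_list (map L xs) \<le> t + 1}"
    by (rule heavy_unit_window_replicate_pmf[of QZ L, folded P_def]) (rule that)
  have upper: "dv n \<le> ereal (1 - log 2 c + 1 / 2 * log 2 n)" if n: "n \<ge> 1" for n
  proof -
    obtain t where t: "c / sqrt n \<le> measure_pmf.prob (P n)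
       {xs. t \<le> sum_list (map L xs) \<and> sum_list (map L xs) \<le> t + 1}"
      using heavy[OF n] by blast
    \<comment> \<open>The competing code. Intersecting with the support keeps its mass and makes its
      divergence finite.\<close>
    define T where "T = {ys. t \<le> - log 2 (pmf (QA n) ys) \<and> - log 2 (pmf (QA n) ys) \<le> t + 1}
      \<inter> set_pmf (QA n)"
    have "measure_pmf.prob (QA n) T = measure_pmf.prob (P n)
       {xs. t \<le> sum_list (map L xs) \<and> sum_list (map L xs) \<le> t + 1}"
      using prob_QA[OF n, of "\<lambda>w. t \<le> w \<and> w \<le> t + 1"] by (simp add: T_def measure_Int_set_pmf)
    with t have prob: "c / sqrt n \<le> measure_pmf.prob (QA n) T" by simp
    have cn: "c / sqrt n > 0" using c n by simp
    have ne: "T \<noteq> {}" using prob cn by auto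
    have "set_pmf (QA n) = f n ` set_pmf (P n)"
      by (simp add: target[OF n] P_def)
    also have "\<dots> \<subseteq> seqs n"
      using bij_betw_imp_surj_on[OF invertible[OF n]] P_seqs by blast
    finally have sub: "T \<subseteq> seqs n" by (auto simp: T_def)
    have "finite (seqs n :: 'a list set)"
      using finite_lists_length_eq[of "UNIV :: 'a set" n] by (simp add: seqs_def)
    with sub have fin: "finite T" by (rule finite_subset)
    have "dv n \<le> divergence (pmf_of_set T) (QA n)"
      using optimal[OF n] ne sub by (auto simp: dv_def optimal_code_def is_arg_min_def not_less)
    also have "\<dots> \<le> ereal (1 - log 2 (measure_pmf.prob (QA n) T))"
      using fin ne by (intro divergence_le[where t = t]) (auto simp: T_def)
    also have "\<dots> \<le> ereal (1 - log 2 (c / sqrt n))"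
      using prob cn by simp
    also have "log 2 (c / sqrt n) = log 2 c - 1 / 2 * log 2 n"
      using c n by (simp add: log_divide powr_half_sqrt[symmetric] log_powr)
    finally show ?thesis by (simp add: algebra_simps)
  qed

  have "(\<lambda>n. (1 / 2 * log 2 (1 + a * n) - K) / (1 / 2 * log 2 (real n))) \<longlonglongrightarrow> 1"
    using a by real_asymp
  moreover have "(\<lambda>n. (1 - log 2 c + 1 / 2 * log 2 n) / (1 / 2 * log 2 (real n))) \<longlonglongrightarrow> 1"
    using c by real_asymp
  ultimately have lim: "(\<lambda>n. ereal ((1 / 2 * log 2 (1 + a * n) - K) / (1 / 2 * log 2 (real n)))) \<longlonglongrightarrow> 1"
    "(\<lambda>n. ereal ((1 - log 2 c + 1 / 2 * log 2 n) / (1 / 2 * log 2 (real n)))) \<longlonglongrightarrow> 1"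
    by (simp_all add: one_ereal_def)
  \<comment> \<open>From \<open>n = 2\<close> on the denominator is positive; the two real bounds
    force \<open>dv n\<close> to be finite, so the quotient is one of reals.\<close>
  have "dv n / ereal (1 / 2 * log 2 (real n)) \<in>
      {ereal ((1 / 2 * log 2 (1 + a * n) - K) / (1 / 2 * log 2 (real n))) ..
       ereal ((1 - log 2 c + 1 / 2 * log 2 n) / (1 / 2 * log 2 (real n)))}" if n: "n \<ge> 2" for n
  proof -
    have pos: "1 / 2 * log 2 (real n) > 0" using n by simp
    obtain d where d: "dv n = ereal d"
      using lower[of n] upper[of n] n by (cases "dv n") auto
    have "1 / 2 * log 2 (1 + a * n) - K \<le> d" "d \<le> 1 - log 2 c + 1 / 2 * log 2 n"
      using lower[of n] upper[of n] n by (auto simp: d)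
    then show ?thesis
      using pos by (auto simp: d intro!: divide_right_mono)
  qed
  then have "\<forall>\<^sub>F n in sequentially. dv n / ereal (1 / 2 * log 2 (real n)) \<in>
      {ereal ((1 / 2 * log 2 (1 + a * n) - K) / (1 / 2 * log 2 (real n))) ..
       ereal ((1 - log 2 c + 1 / 2 * log 2 n) / (1 / 2 * log 2 (real n)))}"
    using eventually_ge_at_top[of 2] by (rule eventually_mono[rotated])
  then have "(\<lambda>n. dv n / ereal (1 / 2 * log 2 (real n))) \<longlonglongrightarrow> 1"
    by (intro tendsto_sandwich[OF _ _ lim]) (auto elim: eventually_mono)
  then show ?thesis by (simp only: dv_def)
qed

end
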